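(* Let $A=[a_1\ \cdots\ a_n]\in\mathbb{R}^{d\times n}$ have columns satisfying $\|a_i\|=1$ for $i=1,\dots,n$. Then the radius of the minimum enclosing ball of $\mathrm{conv}(A)$ is $\sqrt{1-(\rho_A^+)^2}$.
   Context: $\mathrm{conv}(A)$ is the convex hull of the columns of $A$, and $\mathrm{lin}(A)=\{A\alpha:\alpha\in\mathbb{R}^n\}$ is their linear span. $\triangle=\{p\in\mathbb{R}^n: p\ge\mathbf{0},\ \|p\|_1=1\}$ is the probability simplex; $\|\cdot\|$ is the Euclidean norm. The affine-margin of $A$ is $\rho_A:=\sup\{\inf_{p\in\triangle}w^TAp : w\in\mathrm{lin}(A),\ \|w\|=1\}$, and $\rho_A^+:=\max\{0,\rho_A\}$. The minimum enclosing ball of a bounded set in $\mathbb{R}^d$ is the closed Euclidean ball of smallest radius (with arbitrary center $c\in\mathbb{R}^d$) containing it; for $\mathrm{conv}(A)$ its radius $r$ is obtained by minimizing $r^2$ over $(c,r)$ subject to $\|c-a_i\|^2\le r^2$ for all $i=1,\dots,n$. *)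

theory Defs
  imports "HOL-Analysis.Analysis"
begin

definition conv_cols :: "real^'n^'d \<Rightarrow> (real^'d) set" where
  "conv_cols A = convex hull (columns A)"

definition lin :: "real^'n^'d \<Rightarrow> (real^'d) set" where
  "lin A = {A *v \<alpha> | \<alpha>. True}"

definition prob_simplex :: "(real^'n) set" where
  "prob_simplex = {p. (\<forall>i. 0 \<le> p $ i) \<and> (\<Sum>i\<in>UNIV. \<bar>p $ i\<bar>) = 1}"

(* Both extrema are over nonempty bounded sets of reals as soon as A is nonzero;
   for A = 0 there is no unit vector in lin A and the value is unspecified. *)
definition affine_margin :: "real^'n^'d \<Rightarrow> real" where
  "affine_margin A =
     (SUP w \<in> {w \<in> lin A. norm w = 1}. INF p \<in> prob_simplex. w \<bullet> (A *v p))"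

definition affine_margin_pos :: "real^'n^'d \<Rightarrow> real" where
  "affine_margin_pos A = max 0 (affine_margin A)"

(* A relation rather than a function, so that asserting it includes the existence
   of a ball of smallest radius; r is determined by S. *)
definition is_min_enclosing_ball :: "'a::metric_space set \<Rightarrow> 'a \<Rightarrow> real \<Rightarrow> bool" where
  "is_min_enclosing_ball S c r \<longleftrightarrow>
     0 \<le> r \<and> S \<subseteq> cball c r \<and>
     (\<forall>c' r'. 0 \<le> r' \<and> S \<subseteq> cball c' r' \<longrightarrow> r \<le> r')"

end

theory Submission
  imports Defs
begin

text \<open>Let \<open>q\<close> be the point of the convex hull nearest to the origin. The hull lies in the half-space
  \<open>q \<bullet> q \<le> q \<bullet> x\<close>, so for unit columns \<open>q\<close> is the centre of an enclosing ball of squared radius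
  \<open>1 - (norm q)\<^sup>2\<close>; averaging the constraints of any other enclosing ball with the
  weights that represent \<open>q\<close> shows that this is optimal. The same half-space gives
  \<open>norm q\<close> as the positive part of the margin, attained at \<open>q /\<^sub>R norm q\<close> when \<open>q \<noteq> 0\<close>.\<close>

text \<open>Turns the infimum over the simplex in \<open>affine_margin\<close> into one over the
  hull, where the nearest point lives.\<close>

lemma conv_cols_eq_image: "conv_cols A = (\<lambda>p. A *v p) ` prob_simplex" for A :: "real^'n^'d"
proof
  have "convex (prob_simplex :: (real^'n) set)"
    unfolding convex_def prob_simplex_def
    by (auto simp: sum.distrib sum_distrib_left[symmetric])
  then have "convex ((\<lambda>p. A *v p) ` prob_simplex)"
    by (intro convex_linear_image) auto
  moreover have "columns A \<subseteq> (\<lambda>p. A *v p) ` prob_simplex"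
  proof
    fix x assume "x \<in> columns A"
    then obtain i where "x = A *v axis i 1"
      by (auto simp: columns_def matrix_vector_mult_basis)
    moreover have "axis i 1 \<in> (prob_simplex :: (real^'n) set)"
      by (auto simp: prob_simplex_def axis_def if_distrib[of abs] cong: if_cong)
    ultimately show "x \<in> (\<lambda>p. A *v p) ` prob_simplex" by blast
  qed
  ultimately show "conv_cols A \<subseteq> (\<lambda>p. A *v p) ` prob_simplex"
    unfolding conv_cols_def by (rule hull_minimal[rotated])
  show "(\<lambda>p. A *v p) ` prob_simplex \<subseteq> conv_cols A"
  proof
    fix x assume "x \<in> (\<lambda>p. A *v p) ` prob_simplex"
    then obtain p where p: "p \<in> prob_simplex" "x = A *v p" by blast
    have "(\<Sum>i\<in>UNIV. p $ i *\<^sub>R column i A) \<in> convex hull (columns A)"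
      using p by (intro convex_sum) (auto simp: prob_simplex_def columns_def intro!: hull_inc)
    then show "x \<in> conv_cols A"
      by (simp add: p matrix_mult_sum scalar_mult_eq_scaleR conv_cols_def)
  qed
qed

lemma compact_conv_cols: "compact (conv_cols A)"
  unfolding conv_cols_def by (intro finite_imp_compact_convex_hull) (simp add: columns_def full_SetCompr_eq)

lemma column_in_conv_cols: "column i A \<in> conv_cols A"
  unfolding conv_cols_def columns_def by (blast intro: hull_inc)

lemma conv_cols_nearest_origin:
  obtains q where "q \<in> conv_cols A" "\<And>x. x \<in> conv_cols A \<Longrightarrow> q \<bullet> q \<le> q \<bullet> x"
proof -
  have ne: "conv_cols A \<noteq> {}" using column_in_conv_cols by blast
  have cl: "closed (conv_cols A)" using compact_conv_cols compact_imp_closed by blast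
  have cv: "convex (conv_cols A)" by (simp add: conv_cols_def)
  obtain q where q: "q \<in> conv_cols A" "\<And>x. x \<in> conv_cols A \<Longrightarrow> dist 0 q \<le> dist 0 x"
    using distance_attains_inf[OF cl ne] by metis
  \<comment> \<open>The variational inequality for the projection of the origin:
    \<open>(0 - q) \<bullet> (x - q) \<le> 0\<close>.\<close>
  have "q \<bullet> q \<le> q \<bullet> x" if "x \<in> conv_cols A" for x
    using any_closest_point_dot[OF cv cl q(1) that, of 0] q(2)
    by (simp add: inner_diff_right)
  with q(1) show thesis by (rule that)
qed

lemma affine_margin_pos_eq_norm:
  fixes A :: "real^'n^'d"
  assumes unit: "\<And>i. norm (column i A) = 1"
    and q: "q \<in> conv_cols A" "\<And>x. x \<in> conv_cols A \<Longrightarrow> q \<bullet> q \<le> q \<bullet> x"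
  shows "affine_margin_pos A = norm q"
proof -
  define W where "W = {w \<in> lin A. norm w = 1}"
  define f where "f w = (INF p\<in>prob_simplex. w \<bullet> (A *v p))" for w
  have margin: "affine_margin A = (SUP w\<in>W. f w)"
    unfolding affine_margin_def W_def f_def ..
  have f: "f w = (INF x\<in>conv_cols A. w \<bullet> x)" for w
    unfolding f_def conv_cols_eq_image image_image ..
  have bdd: "bdd_below ((\<bullet>) w ` conv_cols A)" for w
    by (intro bounded_imp_bdd_below compact_imp_bounded compact_continuous_image
        compact_conv_cols continuous_intros)
  have le: "f w \<le> norm q" if "w \<in> W" for w
  proof -
    have "f w \<le> w \<bullet> q" unfolding f by (rule cINF_lower[OF bdd q(1)])
    also have "\<dots> \<le> norm w * norm q" by (rule norm_cauchy_schwarz)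
    finally show ?thesis using that by (simp add: W_def)
  qed
  have lin: "conv_cols A \<subseteq> lin A" unfolding conv_cols_eq_image lin_def by blast
  \<comment> \<open>An arbitrary column serves as witness that \<open>W\<close> is nonempty, so that
    the supremum can be bounded from above.\<close>
  have "column undefined A \<in> W"
    using lin column_in_conv_cols unit by (auto simp: W_def)
  then have upper: "affine_margin A \<le> norm q"
    unfolding margin using le by (intro cSUP_least) auto
  show ?thesis
  proof (cases "q = 0")
    \<comment> \<open>The margin itself may be negative here; the upper bound 0 already makes its
      positive part vanish.\<close>
    case True
    then show ?thesis using upper by (simp add: affine_margin_pos_def)
  next
    case False
    from q(1) lin obtain \<alpha> where "q = A *v \<alpha>" by (auto simp: lin_def)
    then have "q /\<^sub>R norm q = A *v (\<alpha> /\<^sub>R norm q)"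
      by (simp add: matrix_vector_mult_scaleR)
    then have "q /\<^sub>R norm q \<in> lin A" unfolding lin_def by blast
    then have w: "q /\<^sub>R norm q \<in> W"
      using False by (simp add: W_def)
    have "norm q \<le> (q /\<^sub>R norm q) \<bullet> x" if "x \<in> conv_cols A" for x
      using q(2)[OF that] False
      by (simp add: field_simps power2_eq_square flip: power2_norm_eq_inner)
    then have "norm q \<le> f (q /\<^sub>R norm q)"
      unfolding f using q(1) by (intro cINF_greatest) auto
    also have "\<dots> \<le> affine_margin A"
      unfolding margin using le w by (intro cSUP_upper) (auto intro!: bdd_aboveI2[of _ _ "norm q"])
    finally show ?thesis using upper norm_ge_zero[of q]
      unfolding affine_margin_pos_def by linarith
  qed
qed

lemma min_enclosing_ball_nearest_origin:
  fixes A :: "real^'n^'d"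
  assumes unit: "\<And>i. norm (column i A) = 1"
    and q: "q \<in> conv_cols A" "\<And>x. x \<in> conv_cols A \<Longrightarrow> q \<bullet> q \<le> q \<bullet> x"
  shows "is_min_enclosing_ball (conv_cols A) q (sqrt (1 - (norm q)\<^sup>2))"
proof -
  \<comment> \<open>Unit columns make the squared distance from a fixed \<open>c\<close> affine in
    the column, so each enclosing-ball constraint becomes a half-space constraint.\<close>
  have sq: "(dist c (column i A))\<^sup>2 = 1 - 2 * (c \<bullet> column i A) + c \<bullet> c" for c i
    using unit[of i] unfolding dist_norm power2_norm_eq_inner
    by (simp add: inner_diff inner_commute norm_eq_1)
  have "dist q (column i A) \<le> sqrt (1 - (norm q)\<^sup>2)" for i
    using q(2)[OF column_in_conv_cols, of i]
    by (intro real_le_rsqrt) (simp add: sq power2_norm_eq_inner)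
  then have cover: "conv_cols A \<subseteq> cball q (sqrt (1 - (norm q)\<^sup>2))"
    unfolding conv_cols_def columns_def by (intro hull_minimal) auto
  \<comment> \<open>\<open>sqrt\<close> is negative at negative arguments; the sign follows because
    the ball contains its own centre \<open>q\<close>.\<close>
  then have "0 \<le> sqrt (1 - (norm q)\<^sup>2)"
    using q(1) by auto
  moreover have "sqrt (1 - (norm q)\<^sup>2) \<le> r"
    if r: "0 \<le> r" and sub: "conv_cols A \<subseteq> cball c r" for c r
  proof (rule real_le_lsqrt)
    have "1 + c \<bullet> c - r\<^sup>2 \<le> 2 * (c \<bullet> column i A)" for i
      using sub column_in_conv_cols[of i A] sq[of c i] power_mono[of "dist c (column i A)" r 2]
      by auto
    \<comment> \<open>The half-space passes the column bounds to the hull, hence to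
      \<open>q\<close>, in place of explicit weights.\<close>
    then have "conv_cols A \<subseteq> {x. c \<bullet> x \<ge> (1 + c \<bullet> c - r\<^sup>2) / 2}"
      unfolding conv_cols_def columns_def
      by (intro hull_minimal convex_halfspace_ge) (auto simp: field_simps)
    with q(1) have "1 + c \<bullet> c - r\<^sup>2 \<le> 2 * (c \<bullet> q)" by (auto simp: field_simps)
    \<comment> \<open>Completing the square:
      \<open>1 - r\<^sup>2 \<le> 2 * (c \<bullet> q) - c \<bullet> c\<close>, and the right side is
      \<open>q \<bullet> q - (c - q) \<bullet> (c - q)\<close>.\<close>
    moreover have "0 \<le> (c - q) \<bullet> (c - q)" by simp
    ultimately show "1 - (norm q)\<^sup>2 \<le> r\<^sup>2"
      by (simp add: inner_diff inner_commute power2_norm_eq_inner)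
  qed (use r in auto)
  ultimately show ?thesis using cover unfolding is_min_enclosing_ball_def by blast
qed

theorem proposition2:
  fixes A :: "real^'n^'d"
  assumes "\<And>i. norm (column i A) = 1"
  shows "\<exists>c. is_min_enclosing_ball (conv_cols A) c (sqrt (1 - (affine_margin_pos A)\<^sup>2))"
proof -
  obtain q where "q \<in> conv_cols A" "\<And>x. x \<in> conv_cols A \<Longrightarrow> q \<bullet> q \<le> q \<bullet> x"
    using conv_cols_nearest_origin by blast
  with assms show ?thesis
    using min_enclosing_ball_nearest_origin affine_margin_pos_eq_norm by metis
qed

end
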